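(* Let $G$ be a countable group acting faithfully on a rooted tree $\mathcal T$, and let $\rho_{\mathcal T}$ be the associated unitary representation of $G$ on $\ell^2(\mathcal T^0)$. Let $\lambda$ be the regular representation of $G$. (i) If for every vertex $v\in\mathcal T^0$ the stabilizer $\mathrm{Stab}_G(v\mathcal T)$ is trivial, then $\lambda\prec\rho_{\mathcal T}$. (ii) More generally, if the set $\bigcup_{v\in\mathcal T^0}\mathrm{Stab}_G(v\mathcal T)$ is finite and has cardinality $n$, then $\lambda\prec\rho_{\mathcal T}^{\otimes n}$. (iii) One always has $\lambda\prec\bigoplus_{n=1}^{+\infty}\rho_{\mathcal T}^{\otimes n}$.
   Context: Rooted tree: given a sequence $\bar d=d_0,d_1,\dots$ of integers $d_i\geq 2$, the rooted tree $\mathcal T=\mathcal T_{\bar d}$ is the infinite locally finite tree with a distinguished vertex $\varnothing$ (the root) of degree $d_0$ in which every vertex at distance $n\geq1$ from the root has degree $d_n+1$. $\mathcal T^0$ is its set of vertices and the $n$-th level $L_n$ is the set of vertices at distance $n$ from the root. For $v\in\mathcal T^0$, the subtree $v\mathcal T$ is the connected subgraph whose vertices are the descendants of $v$, i.e. the vertices $w$ such that $v$ lies on the geodesic path from $\varnothing$ to $w$. An action of a countable group $G$ on $\mathcal T$ is an action by graph automorphisms fixing the root. It induces the unitary representation $\rho_{\mathcal T}$ of $G$ on $\ell^2(\mathcal T^0)$, $\rho_{\mathcal T}(g)(\xi)(v)=\xi(g^{-1}\cdot v)$. For $v\in\mathcal T^0$, $\mathrm{Stab}_G(v\mathcal T):=\{g\in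 G\mid g(x)=x\ \text{for all vertices } x\in v\mathcal T\}$ (pointwise stabilizer). $\rho_{\mathcal T}^{\otimes n}$ is the $n$-fold tensor power, i.e. the permutation representation on $\ell^2((\mathcal T^0)^n)$ for the diagonal action. The regular representation $\lambda$ of $G$ on $\ell^2(G)$ is $\lambda(g)(\xi)(h)=\xi(g^{-1}h)$. Weak containment: $\pi_1\prec\pi_2$ for unitary representations $(\pi_1,\mathcal H_1)$, $(\pi_2,\mathcal H_2)$ of $G$ means that for all $\epsilon>0$, $\xi\in\mathcal H_1$ and finite $K\subset G$ there are vectors $\nu_1,\dots,\nu_m\in\mathcal H_2$ such that for all $g\in K$, $\left|\langle \pi_1(g)\xi\,|\,\xi\rangle-\sum_{i=1}^m\langle\pi_2(g)\nu_i\,|\,\nu_i\rangle\right|<\epsilon$. *)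

theory Defs
  imports "HOL-Algebra.Group_Action" "HOL-Analysis.Infinite_Sum"
begin

section \<open>Rooted trees\<close>

text \<open>A simple graph is given by a vertex set and an adjacency relation; walks are
  nonempty lists of vertices, of length (number of edges) one less than the list.\<close>

definition walk :: "'v set \<Rightarrow> ('v \<Rightarrow> 'v \<Rightarrow> bool) \<Rightarrow> 'v \<Rightarrow> 'v \<Rightarrow> 'v list \<Rightarrow> bool" where
  "walk V adj x y p \<longleftrightarrow>
     p \<noteq> [] \<and> hd p = x \<and> last p = y \<and> set p \<subseteq> V \<and> successively adj p"

definition graph_dist :: "'v set \<Rightarrow> ('v \<Rightarrow> 'v \<Rightarrow> bool) \<Rightarrow> 'v \<Rightarrow> 'v \<Rightarrow> nat" where
  "graph_dist V adj x y = (LEAST n. \<exists>p. walk V adj x y p \<and> length p = Suc n)"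

definition geodesic :: "'v set \<Rightarrow> ('v \<Rightarrow> 'v \<Rightarrow> bool) \<Rightarrow> 'v \<Rightarrow> 'v \<Rightarrow> 'v list \<Rightarrow> bool" where
  "geodesic V adj x y p \<longleftrightarrow>
     walk V adj x y p \<and> length p = Suc (graph_dist V adj x y)"

definition graph_cycle :: "'v set \<Rightarrow> ('v \<Rightarrow> 'v \<Rightarrow> bool) \<Rightarrow> 'v list \<Rightarrow> bool" where
  "graph_cycle V adj c \<longleftrightarrow>
     3 \<le> length c \<and> distinct c \<and> set c \<subseteq> V \<and> successively adj c \<and> adj (last c) (hd c)"

definition vertex_degree :: "'v set \<Rightarrow> ('v \<Rightarrow> 'v \<Rightarrow> bool) \<Rightarrow> 'v \<Rightarrow> nat" where
  "vertex_degree V adj x = card {y \<in> V. adj x y}"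

locale tree =
  fixes V :: "'v set" and adj :: "'v \<Rightarrow> 'v \<Rightarrow> bool"
  assumes adj_verts: "adj x y \<Longrightarrow> x \<in> V \<and> y \<in> V"
    and adj_sym: "adj x y \<Longrightarrow> adj y x"
    and adj_irrefl: "\<not> adj x x"
    and tree_connected: "\<lbrakk>x \<in> V; y \<in> V\<rbrakk> \<Longrightarrow> \<exists>p. walk V adj x y p"
    and tree_acyclic: "\<not> graph_cycle V adj c"

text \<open>Since \<^const>\<open>card\<close> is 0 on infinite sets, the degree conditions below (all degrees being
  positive) force local finiteness.  Infiniteness follows from \<open>2 \<le> d n\<close>.\<close>

locale rooted_tree = tree +
  fixes rt :: 'v and d :: "nat \<Rightarrow> nat"
  assumes root_in: "rt \<in> V"
    and branching: "2 \<le> d n"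
    and degree_root: "vertex_degree V adj rt = d 0"
    and degree_level: "\<lbrakk>v \<in> V; graph_dist V adj rt v = n; 1 \<le> n\<rbrakk>
           \<Longrightarrow> vertex_degree V adj v = d n + 1"

definition subtree :: "'v set \<Rightarrow> ('v \<Rightarrow> 'v \<Rightarrow> bool) \<Rightarrow> 'v \<Rightarrow> 'v \<Rightarrow> 'v set" where
  "subtree V adj rt v = {w \<in> V. \<exists>p. geodesic V adj rt w p \<and> v \<in> set p}"

section \<open>Actions on rooted trees\<close>

locale rooted_tree_action =
  rooted_tree V adj rt d + group_action G V \<phi>
  for V :: "'v set" and adj rt d
    and G :: "('g, 'm) monoid_scheme" (structure) and \<phi> :: "'g \<Rightarrow> 'v \<Rightarrow> 'v" +
  assumes adj_preserved:
      "\<lbrakk>g \<in> carrier G; x \<in> V; y \<in> V\<rbrakk> \<Longrightarrow> adj (\<phi> g x) (\<phi> g y) \<longleftrightarrow> adj x y"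
    and root_fixed: "g \<in> carrier G \<Longrightarrow> \<phi> g rt = rt"

definition pointwise_stabilizer ::
    "('g, 'm) monoid_scheme \<Rightarrow> ('g \<Rightarrow> 'v \<Rightarrow> 'v) \<Rightarrow> 'v set \<Rightarrow> 'g set" where
  "pointwise_stabilizer G \<phi> X = {g \<in> carrier G. \<forall>x\<in>X. \<phi> g x = x}"

section \<open>Unitary representations\<close>

text \<open>The data of a unitary representation: the set of vectors of the Hilbert space, its inner
  product, and the action of the group.\<close>

record ('g, 'h) rep =
  vectors :: "'h set"
  ip :: "'h \<Rightarrow> 'h \<Rightarrow> complex"
  act :: "'g \<Rightarrow> 'h \<Rightarrow> 'h"

text \<open>\<open>\<ell>\<^sup>2(X)\<close> for a subset \<open>X\<close> of a type; vectors are extended by 0 outside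
  \<open>X\<close>.  The inner product is linear in the first argument; the opposite convention conjugates
  every matrix coefficient and gives the same notion of weak containment.\<close>

definition ell2 :: "'x set \<Rightarrow> ('x \<Rightarrow> complex) set" where
  "ell2 X = {\<xi>. (\<forall>x. x \<notin> X \<longrightarrow> \<xi> x = 0) \<and> (\<lambda>x. (cmod (\<xi> x))\<^sup>2) summable_on X}"

definition ell2_ip :: "'x set \<Rightarrow> ('x \<Rightarrow> complex) \<Rightarrow> ('x \<Rightarrow> complex) \<Rightarrow> complex" where
  "ell2_ip X \<xi> \<eta> = (\<Sum>\<^sub>\<infinity>x\<in>X. \<xi> x * cnj (\<eta> x))"

definition permutation_rep ::
    "('g, 'm) monoid_scheme \<Rightarrow> 'x set \<Rightarrow> ('g \<Rightarrow> 'x \<Rightarrow> 'x) \<Rightarrow> ('g, 'x \<Rightarrow> complex) rep" where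
  "permutation_rep G X \<alpha> =
     \<lparr> vectors = ell2 X,
       ip = ell2_ip X,
       act = (\<lambda>g \<xi> x. if x \<in> X then \<xi> (\<alpha> (inv\<^bsub>G\<^esub> g) x) else 0) \<rparr>"

definition regular_rep :: "('g, 'm) monoid_scheme \<Rightarrow> ('g, 'g \<Rightarrow> complex) rep" where
  "regular_rep G = permutation_rep G (carrier G) (\<lambda>g h. g \<otimes>\<^bsub>G\<^esub> h)"

text \<open>The \<open>n\<close>-th tensor power of the permutation representation on \<open>\<ell>\<^sup>2(X)\<close>, realised on
  \<open>\<ell>\<^sup>2(X\<^sup>n)\<close> with the diagonal action; \<open>n\<close>-tuples are lists of length \<open>n\<close>.\<close>

definition permutation_rep_power ::
    "('g, 'm) monoid_scheme \<Rightarrow> 'x set \<Rightarrow> ('g \<Rightarrow> 'x \<Rightarrow> 'x) \<Rightarrow> nat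
       \<Rightarrow> ('g, 'x list \<Rightarrow> complex) rep" where
  "permutation_rep_power G X \<alpha> n =
     permutation_rep G {xs. set xs \<subseteq> X \<and> length xs = n} (\<lambda>g. map (\<alpha> g))"

text \<open>The Hilbert space direct sum, i.e. square-summable families.\<close>

definition direct_sum_rep ::
    "'i set \<Rightarrow> ('i \<Rightarrow> ('g, 'h) rep) \<Rightarrow> ('g, 'i \<Rightarrow> 'h) rep" where
  "direct_sum_rep I \<pi> =
     \<lparr> vectors = {f \<in> PiE I (\<lambda>i. vectors (\<pi> i)).
                    (\<lambda>i. Re (ip (\<pi> i) (f i) (f i))) summable_on I},
       ip = (\<lambda>f f'. \<Sum>\<^sub>\<infinity>i\<in>I. ip (\<pi> i) (f i) (f' i)),
       act = (\<lambda>g f. \<lambda>i\<in>I. act (\<pi> i) g (f i)) \<rparr>"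

text \<open>The vectors \<open>\<nu>\<^sub>1, \<dots>, \<nu>\<^sub>m\<close> form the list \<open>\<nu>s\<close>; allowing \<open>m = 0\<close> makes no
  difference, as 0 is a vector.\<close>

definition weakly_contained ::
    "('g, 'm) monoid_scheme \<Rightarrow> ('g, 'h) rep \<Rightarrow> ('g, 'k) rep \<Rightarrow> bool" where
  "weakly_contained G \<pi>\<^sub>1 \<pi>\<^sub>2 \<longleftrightarrow>
     (\<forall>\<epsilon>>0. \<forall>\<xi>\<in>vectors \<pi>\<^sub>1. \<forall>K. finite K \<and> K \<subseteq> carrier G \<longrightarrow>
        (\<exists>\<nu>s. set \<nu>s \<subseteq> vectors \<pi>\<^sub>2 \<and>
           (\<forall>g\<in>K. cmod (ip \<pi>\<^sub>1 (act \<pi>\<^sub>1 g \<xi>) \<xi> -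
                        (\<Sum>\<nu>\<leftarrow>\<nu>s. ip \<pi>\<^sub>2 (act \<pi>\<^sub>2 g \<nu>) \<nu>)) < \<epsilon>)))"

end

theory Submission
  imports Defs
begin

text \<open>
  The three statements follow from one principle: the regular representation is weakly contained
  in a permutation representation on \<open>\<ell>\<^sup>2(X)\<close> as soon as every finite set \<open>K\<close> of
  nontrivial group elements has a \<^emph>\<open>common\<close> point \<open>x \<in> X\<close> moved by all of \<open>K\<close>.  For a finitely
  supported vector \<open>\<xi>\<close> of \<open>\<ell>\<^sup>2(G)\<close> and finitely many group elements, the matrix coefficients
  of \<open>\<xi>\<close> only involve finitely many \<open>h \<in> G\<close>.  If \<open>x\<close> is moved by their pairwise quotients, then
  \<open>h \<mapsto> h x\<close> is injective on them and transports \<open>\<xi>\<close> to a vector of \<open>\<ell>\<^sup>2(X)\<close> with exactly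
  the same coefficients.  A general vector of \<open>\<ell>\<^sup>2(G)\<close> is first cut off to a finite set, which
  changes all its coefficients by less than \<open>\<epsilon>\<close>.  For a direct sum it is enough that the point
  exists in one of the summands, and the summand may depend on \<open>K\<close>.  This is
  \<open>regular_weakly_contained\<close> and \<open>regular_weakly_contained_direct_sum\<close>.

  The tree provides the common point.  An automorphism fixing the root and a vertex \<open>w\<close> maps the
  geodesic between them to a geodesic with the same ends, hence fixes it pointwise, since geodesics
  in a tree are unique (\<open>geodesic_unique\<close>).  So whatever moves a vertex \<open>v\<close> also moves all the
  descendants of \<open>v\<close>.  Given finitely many elements, none of which fixes a whole subtree, one can
  therefore walk down the tree and take care of one element after the other: inside the subtree
  of a vertex moved by the previous elements there is a vertex moved by the next one
  (\<open>ex_vertex_moved_by_all\<close>).  This settles the case of trivial stabilizers.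

  If \<open>n\<close> elements, the identity among them, fix some subtree pointwise, then each of the other
  \<open>n - 1\<close> moves some vertex because the action is faithful.  These vertices, together with one
  vertex moved by all elements of \<open>K\<close> fixing no subtree, form an \<open>n\<close>-tuple moved by all of \<open>K\<close>.
  Without any assumption on the stabilizers, a tuple with one entry for each element of \<open>K\<close> does
  the same, but its length depends on \<open>K\<close>; hence the direct sum over all tensor powers.
\<close>

section \<open>Permutation actions and matrix coefficients\<close>

text \<open>Unlike in \<^locale>\<open>group_action\<close>, nothing is asked of \<open>\<alpha> g\<close> outside \<open>X\<close>.  The diagonal
  action \<open>map (\<alpha> g)\<close> on tuples and the multiplication of \<open>G\<close> are not extended by
  \<^const>\<open>undefined\<close> there, hence are not elements of \<^const>\<open>BijGroup\<close>.\<close>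

locale set_action = group G for G :: "('g, 'm) monoid_scheme" (structure) +
  fixes X :: "'x set" and \<alpha> :: "'g \<Rightarrow> 'x \<Rightarrow> 'x"
  assumes act_closed: "\<lbrakk>g \<in> carrier G; x \<in> X\<rbrakk> \<Longrightarrow> \<alpha> g x \<in> X"
    and act_mult: "\<lbrakk>g \<in> carrier G; h \<in> carrier G; x \<in> X\<rbrakk> \<Longrightarrow> \<alpha> (g \<otimes> h) x = \<alpha> g (\<alpha> h x)"
    and act_one: "x \<in> X \<Longrightarrow> \<alpha> \<one> x = x"
begin

lemma act_inv_act:
  assumes "g \<in> carrier G" "x \<in> X"
  shows "\<alpha> (inv g) (\<alpha> g x) = x" "\<alpha> g (\<alpha> (inv g) x) = x"
  using assms by (simp_all flip: act_mult add: act_one)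

lemma act_bij: "g \<in> carrier G \<Longrightarrow> bij_betw (\<alpha> g) X X"
  by (rule bij_betw_byWitness[where f' = "\<alpha> (inv g)"])
     (auto simp: act_inv_act act_closed)

lemma permutation_rep_coeff:
  "ip (permutation_rep G X \<alpha>) (act (permutation_rep G X \<alpha>) g \<xi>) \<eta>
     = (\<Sum>\<^sub>\<infinity>x\<in>X. \<xi> (\<alpha> (inv g) x) * cnj (\<eta> x))"
  by (auto simp: permutation_rep_def ell2_ip_def intro: infsum_cong)

text \<open>The two coefficients differ only in terms where \<open>x\<close> or \<open>\<alpha> g x\<close> lies outside \<open>F\<close>.  There,
  by the weighted inequality \<open>a b \<le> (t a\<^sup>2 + b\<^sup>2 / t) / 2\<close> with \<open>b\<close> the factor outside
  \<open>F\<close>, the total is at most \<open>t\<close> times the squared norm of \<open>\<xi>\<close> plus \<open>1 / t\<close> times the squared norm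
  of its tail.  As \<open>\<alpha> g\<close> permutes \<open>X\<close>, this bound does not depend on \<open>g\<close>, so one \<open>F\<close> serves
  for all group elements.\<close>

lemma finite_support_approx:
  fixes \<epsilon> :: real
  assumes "\<epsilon> > 0" and \<xi>: "\<xi> \<in> ell2 X"
  obtains F where "finite F" "F \<subseteq> X"
    "\<And>g. g \<in> carrier G \<Longrightarrow>
       cmod ((\<Sum>\<^sub>\<infinity>x\<in>X. \<xi> (\<alpha> g x) * cnj (\<xi> x))
           - (\<Sum>\<^sub>\<infinity>x\<in>X. (if \<alpha> g x \<in> F then \<xi> (\<alpha> g x) else 0)
                * cnj (if x \<in> F then \<xi> x else 0))) < \<epsilon>"
proof -
  define f where "f x = (cmod (\<xi> x))\<^sup>2" for x
  have f: "f summable_on X" using \<xi> by (simp add: ell2_def f_def[abs_def])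
  define M where "M = infsum f X"
  have M: "M \<ge> 0" unfolding M_def f_def by (intro infsum_nonneg) auto
  \<comment> \<open>\<open>t\<close> is chosen first, so that \<open>t M\<close> is below \<open>\<epsilon> / 2\<close>; then \<open>F\<close>, so that the tail
    divided by \<open>t\<close> is at most \<open>\<epsilon> / 4\<close>.\<close>
  define t where "t = \<epsilon> / (2 * (M + 1))"
  have t: "t > 0" using assms M by (simp add: t_def)
  have tM: "t * M < \<epsilon> / 2" using assms M by (simp add: t_def field_simps)
  obtain F where F: "finite F" "F \<subseteq> X" "dist (sum f F) (infsum f X) \<le> t * \<epsilon> / 4"
    using infsum_finite_approximation[OF f, of "t * \<epsilon> / 4"] t assms by auto
  define r where "r x = (if x \<in> F then 0 else f x)" for x
  have rX: "r summable_on X"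
    by (rule summable_on_comparison_test[OF f]) (auto simp: r_def f_def)
  have "infsum r X = infsum f (X - F)"
    by (rule infsum_cong_neutral) (auto simp: r_def)
  also have "\<dots> = infsum f X - sum f F"
    using F by (subst infsum_Diff) (auto simp: f)
  finally have R: "infsum r X \<le> t * \<epsilon> / 4" using F(3) unfolding dist_real_def by linarith
  define \<eta> where "\<eta> x = (if x \<in> F then \<xi> x else 0)" for x
  have "cmod ((\<Sum>\<^sub>\<infinity>x\<in>X. \<xi> (\<alpha> g x) * cnj (\<xi> x))
           - (\<Sum>\<^sub>\<infinity>x\<in>X. \<eta> (\<alpha> g x) * cnj (\<eta> x))) < \<epsilon>" if g: "g \<in> carrier G" for g
  proof -
    let ?u = "\<lambda>x. \<xi> (\<alpha> g x) * cnj (\<xi> x)" and ?v = "\<lambda>x. \<eta> (\<alpha> g x) * cnj (\<eta> x)"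
    let ?A = "\<lambda>x. t / 2 * (f (\<alpha> g x) + f x) + 1 / (2 * t) * (r (\<alpha> g x) + r x)"
    have young: "a * b \<le> t / 2 * a\<^sup>2 + 1 / (2 * t) * b\<^sup>2" for a b :: real
    proof -
      have "0 \<le> (t * a - b)\<^sup>2 / (2 * t)" using t by simp
      also have "\<dots> = t / 2 * a\<^sup>2 + 1 / (2 * t) * b\<^sup>2 - a * b"
        using t by (simp add: field_simps power2_eq_square)
      finally show ?thesis by simp
    qed
    have pos: "0 \<le> t / 2 * f y" "0 \<le> 1 / (2 * t) * r y" "0 \<le> r y" for y
      using t by (auto simp: f_def r_def)
    have bound: "cmod (?u x - ?v x) \<le> ?A x" for x
    proof -
      let ?a = "cmod (\<xi> (\<alpha> g x))" and ?b = "cmod (\<xi> x)"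
      consider "\<alpha> g x \<in> F" "x \<in> F" | "x \<notin> F" | "\<alpha> g x \<notin> F" by blast
      then show ?thesis
      proof cases
        case 1
        then show ?thesis using pos[of x] pos[of "\<alpha> g x"] by (simp add: \<eta>_def distrib_left)
      next
        case 2
        then have "cmod (?u x - ?v x) = ?a * ?b" by (simp add: \<eta>_def norm_mult)
        also have "\<dots> \<le> t / 2 * f (\<alpha> g x) + 1 / (2 * t) * r x"
          using young[of ?a ?b] 2 by (simp add: f_def r_def)
        finally show ?thesis using pos[of x] pos[of "\<alpha> g x"] unfolding distrib_left by linarith
      next
        case 3
        then have "cmod (?u x - ?v x) = ?b * ?a" by (simp add: \<eta>_def norm_mult)
        also have "\<dots> \<le> t / 2 * f x + 1 / (2 * t) * r (\<alpha> g x)"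
          using young[of ?b ?a] 3 by (simp add: f_def r_def)
        finally show ?thesis using pos[of x] pos[of "\<alpha> g x"] unfolding distrib_left by linarith
      qed
    qed
    have fg: "(\<lambda>x. f (\<alpha> g x)) summable_on X" and rg: "(\<lambda>x. r (\<alpha> g x)) summable_on X"
      using f rX by (simp_all add: summable_on_reindex_bij_betw[OF act_bij[OF g]])
    have sA1: "(\<lambda>x. t / 2 * (f (\<alpha> g x) + f x)) summable_on X"
      and sA2: "(\<lambda>x. 1 / (2 * t) * (r (\<alpha> g x) + r x)) summable_on X"
      by (intro summable_on_cmult_right summable_on_add f rX fg rg)+
    have sA: "?A summable_on X" by (rule summable_on_add[OF sA1 sA2])
    have diff_abs: "(\<lambda>x. ?u x - ?v x) abs_summable_on X"
      by (rule abs_summable_on_comparison_test'[OF sA bound])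
    have v: "?v summable_on X"
    proof (rule finite_nonzero_values_imp_summable_on)
      show "finite {x \<in> X. ?v x \<noteq> 0}"
        by (rule finite_subset[OF _ F(1)]) (auto simp: \<eta>_def)
    qed
    have u: "?u summable_on X"
      using summable_on_add[OF abs_summable_summable[OF diff_abs] v] by simp
    have "cmod (infsum ?u X - infsum ?v X) = cmod (\<Sum>\<^sub>\<infinity>x\<in>X. ?u x - ?v x)"
      using infsum_add[OF abs_summable_summable[OF diff_abs] v] by simp
    also have "\<dots> \<le> (\<Sum>\<^sub>\<infinity>x\<in>X. cmod (?u x - ?v x))"
      by (rule norm_infsum_bound[OF diff_abs])
    also have "\<dots> \<le> infsum ?A X"
      by (rule infsum_mono[OF diff_abs sA bound])
    also have "\<dots> = t / 2 * (M + M) + 1 / (2 * t) * (infsum r X + infsum r X)"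
      unfolding infsum_add[OF sA1 sA2] infsum_cmult_right' infsum_add[OF fg f] infsum_add[OF rg rX]
        infsum_reindex_bij_betw[OF act_bij[OF g]] M_def ..
    also have "\<dots> = t * M + infsum r X / t" using t by (simp add: field_simps)
    also have "infsum r X / t \<le> \<epsilon> / 4" using R t by (simp add: field_simps)
    finally show ?thesis using tM assms by linarith
  qed
  with F show ?thesis by (intro that[of F]) (simp_all add: \<eta>_def)
qed

end

lemma (in group) left_translation_action: "set_action G (carrier G) (\<lambda>g h. g \<otimes> h)"
  by unfold_locales (auto simp: m_assoc)

section \<open>Locally free actions\<close>

text \<open>It is enough to realise the coefficients of finitely supported vectors, exactly and by a
  single vector: the error \<open>\<epsilon>\<close> is spent entirely on the truncation.\<close>

lemma (in group) weakly_contained_regularI: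
  fixes \<pi> :: "('a, 'h) rep"
  assumes coeff: "\<And>F K \<xi>. \<lbrakk>finite F; F \<subseteq> carrier G; \<And>h. h \<notin> F \<Longrightarrow> \<xi> h = 0; finite K; K \<subseteq> carrier G\<rbrakk>
     \<Longrightarrow> \<exists>\<nu>\<in>vectors \<pi>. \<forall>g\<in>K. ip \<pi> (act \<pi> g \<nu>) \<nu> =
           (\<Sum>\<^sub>\<infinity>h\<in>carrier G. \<xi> (inv g \<otimes> h) * cnj (\<xi> h))"
  shows "weakly_contained G (regular_rep G) \<pi>"
proof -
  interpret reg: set_action G "carrier G" "\<lambda>g h. g \<otimes> h" by (rule left_translation_action)
  show ?thesis
    unfolding weakly_contained_def
  proof (intro allI impI ballI, elim conjE)
    fix \<epsilon> :: real and \<xi> K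
    assume \<epsilon>: "\<epsilon> > 0" and \<xi>: "\<xi> \<in> vectors (regular_rep G)" and K: "finite K" "K \<subseteq> carrier G"
    have "\<xi> \<in> ell2 (carrier G)" using \<xi> by (simp add: regular_rep_def permutation_rep_def)
    from reg.finite_support_approx[OF \<epsilon> this] obtain F where F: "finite F" "F \<subseteq> carrier G"
      and approx: "\<And>g. g \<in> carrier G \<Longrightarrow>
       cmod ((\<Sum>\<^sub>\<infinity>x\<in>carrier G. \<xi> (g \<otimes> x) * cnj (\<xi> x))
           - (\<Sum>\<^sub>\<infinity>x\<in>carrier G. (if g \<otimes> x \<in> F then \<xi> (g \<otimes> x) else 0)
                * cnj (if x \<in> F then \<xi> x else 0))) < \<epsilon>" by blast
    obtain \<nu> where \<nu>: "\<nu> \<in> vectors \<pi>" "\<And>g. g \<in> K \<Longrightarrow> ip \<pi> (act \<pi> g \<nu>) \<nu> =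
        (\<Sum>\<^sub>\<infinity>h\<in>carrier G. (if inv g \<otimes> h \<in> F then \<xi> (inv g \<otimes> h) else 0)
             * cnj (if h \<in> F then \<xi> h else 0))"
      using coeff[OF F _ K, of "\<lambda>h. if h \<in> F then \<xi> h else 0"] by auto
    show "\<exists>\<nu>s. set \<nu>s \<subseteq> vectors \<pi> \<and>
        (\<forall>g\<in>K. cmod (ip (regular_rep G) (act (regular_rep G) g \<xi>) \<xi> -
                     (\<Sum>\<nu>\<leftarrow>\<nu>s. ip \<pi> (act \<pi> g \<nu>) \<nu>)) < \<epsilon>)"
    proof (intro exI[of _ "[\<nu>]"] conjI ballI)
      fix g assume "g \<in> K"
      with K have "g \<in> carrier G" by blast
      with approx[of "inv g"] \<nu>(2)[OF \<open>g \<in> K\<close>]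
      show "cmod (ip (regular_rep G) (act (regular_rep G) g \<xi>) \<xi> -
               (\<Sum>\<nu>\<leftarrow>[\<nu>]. ip \<pi> (act \<pi> g \<nu>) \<nu>)) < \<epsilon>"
        by (simp add: regular_rep_def reg.permutation_rep_coeff)
    qed (simp add: \<nu>)
  qed
qed

context set_action
begin

text \<open>If \<open>h x = k x\<close>, the quotient \<open>inv h \<otimes> k\<close> fixes \<open>x\<close>.\<close>

lemma inj_on_orbit_map:
  assumes E: "E \<subseteq> carrier G" and x: "x \<in> X"
    and moved: "\<And>g. g \<in> (\<lambda>(h, k). inv h \<otimes> k) ` (E \<times> E) - {\<one>} \<Longrightarrow> \<alpha> g x \<noteq> x"
  shows "inj_on (\<lambda>h. \<alpha> h x) E"
proof (rule inj_onI, rule ccontr)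
  fix h k assume hk: "h \<in> E" "k \<in> E" "\<alpha> h x = \<alpha> k x" "h \<noteq> k"
  then have c: "h \<in> carrier G" "k \<in> carrier G" using E by auto
  have "inv h \<otimes> k \<noteq> \<one>" using hk(4) c by (metis inv_equality inv_inv inv_closed)
  then have "\<alpha> (inv h \<otimes> k) x \<noteq> x" using hk by (intro moved) auto
  moreover have "\<alpha> (inv h \<otimes> k) x = x"
    using c x hk(3) by (metis act_mult act_inv_act(1) inv_closed)
  ultimately show False by blast
qed

text \<open>The vector \<open>\<nu>\<close> is \<open>\<xi>\<close> transported along \<open>h \<mapsto> h x\<close>.  Injectivity on \<open>F\<close> alone would not be
  enough: the coefficient at \<open>g\<close> compares \<open>h\<close> with \<open>inv g \<otimes> h\<close>, and if the latter lies outside \<open>F\<close>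
  its image must not collide with the image of \<open>F\<close>.  So the translates of \<open>F\<close> by \<open>K\<close> are
  included in \<open>E\<close>.\<close>

lemma finite_support_coeff_transfer:
  assumes F: "finite F" "F \<subseteq> carrier G" and \<xi>: "\<And>h. h \<notin> F \<Longrightarrow> \<xi> h = 0"
    and K: "K \<subseteq> carrier G" and x: "x \<in> X"
    and E_def: "E = F \<union> (\<lambda>(g, h). inv g \<otimes> h) ` (K \<times> F)"
    and inj: "inj_on (\<lambda>h. \<alpha> h x) E"
  shows "\<exists>\<nu>\<in>vectors (permutation_rep G X \<alpha>). \<forall>g\<in>K.
      ip (permutation_rep G X \<alpha>) (act (permutation_rep G X \<alpha>) g \<nu>) \<nu> =
      (\<Sum>\<^sub>\<infinity>h\<in>carrier G. \<xi> (inv g \<otimes> h) * cnj (\<xi> h))"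
proof -
  have E: "F \<subseteq> E" by (auto simp: E_def)
  let ?o = "\<lambda>h. \<alpha> h x"
  define \<nu> where "\<nu> y = (if y \<in> ?o ` E then \<xi> (the_inv_into E ?o y) else 0)" for y
  have \<nu>o: "\<nu> (\<alpha> h x) = \<xi> h" if "h \<in> E" for h
    using that by (simp add: \<nu>_def the_inv_into_f_f[OF inj])
  have \<nu>0: "\<nu> y = 0" if "y \<notin> ?o ` F" for y
  proof (cases "y \<in> ?o ` E")
    case True
    then obtain h where "h \<in> E" "y = \<alpha> h x" by blast
    with that have "h \<notin> F" by blast
    with \<open>h \<in> E\<close> show ?thesis by (simp add: \<open>y = \<alpha> h x\<close> \<nu>o \<xi>)
  qed (simp add: \<nu>_def)
  have oF: "?o ` F \<subseteq> X" using F x act_closed by auto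
  have "(\<lambda>y. (cmod (\<nu> y))\<^sup>2) summable_on X"
  proof (rule finite_nonzero_values_imp_summable_on)
    show "finite {y \<in> X. (cmod (\<nu> y))\<^sup>2 \<noteq> 0}"
      by (rule finite_subset[of _ "?o ` F"]) (use \<nu>0 F in auto)
  qed
  then have "\<nu> \<in> vectors (permutation_rep G X \<alpha>)"
    using \<nu>0 oF by (auto simp: permutation_rep_def ell2_def)
  moreover have "ip (permutation_rep G X \<alpha>) (act (permutation_rep G X \<alpha>) g \<nu>) \<nu> =
      (\<Sum>\<^sub>\<infinity>h\<in>carrier G. \<xi> (inv g \<otimes> h) * cnj (\<xi> h))" if g: "g \<in> K" for g
  proof -
    have gc: "g \<in> carrier G" using g K by auto
    have "(\<Sum>\<^sub>\<infinity>y\<in>X. \<nu> (\<alpha> (inv g) y) * cnj (\<nu> y))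
        = (\<Sum>\<^sub>\<infinity>y\<in>?o ` F. \<nu> (\<alpha> (inv g) y) * cnj (\<nu> y))"
      by (rule infsum_cong_neutral) (use oF \<nu>0 in auto)
    also have "\<dots> = (\<Sum>y\<in>?o ` F. \<nu> (\<alpha> (inv g) y) * cnj (\<nu> y))"
      using F by simp
    also have "\<dots> = (\<Sum>h\<in>F. \<nu> (\<alpha> (inv g) (\<alpha> h x)) * cnj (\<nu> (\<alpha> h x)))"
      by (rule sum.reindex_cong[OF inj_on_subset[OF inj E]]) auto
    also have "\<dots> = (\<Sum>h\<in>F. \<xi> (inv g \<otimes> h) * cnj (\<xi> h))"
    proof (rule sum.cong[OF refl])
      fix h assume h: "h \<in> F"
      then have "inv g \<otimes> h \<in> E" using g by (auto simp: E_def)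
      moreover have "\<alpha> (inv g) (\<alpha> h x) = \<alpha> (inv g \<otimes> h) x"
        using h F gc x by (subst act_mult) auto
      ultimately show "\<nu> (\<alpha> (inv g) (\<alpha> h x)) * cnj (\<nu> (\<alpha> h x)) = \<xi> (inv g \<otimes> h) * cnj (\<xi> h)"
        using h E by (auto simp: \<nu>o)
    qed
    also have "\<dots> = (\<Sum>\<^sub>\<infinity>h\<in>F. \<xi> (inv g \<otimes> h) * cnj (\<xi> h))"
      using F by simp
    also have "\<dots> = (\<Sum>\<^sub>\<infinity>h\<in>carrier G. \<xi> (inv g \<otimes> h) * cnj (\<xi> h))"
      by (rule infsum_cong_neutral) (use F \<xi> in auto)
    finally show ?thesis by (simp add: permutation_rep_coeff)
  qed
  ultimately show ?thesis by blast
qed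

end


section \<open>A combinatorial criterion for weak containment\<close>

text \<open>A vector of one summand, put at its place with zeros elsewhere, keeps its coefficients.\<close>

lemma direct_sum_component_coeff:
  fixes G :: "('g, 'm) monoid_scheme" and X :: "'i \<Rightarrow> 'x set" and \<alpha> :: "'i \<Rightarrow> 'g \<Rightarrow> 'x \<Rightarrow> 'x"
  defines "\<pi> \<equiv> \<lambda>i. permutation_rep G (X i) (\<alpha> i)"
  assumes i: "i \<in> I" and \<nu>: "\<nu> \<in> vectors (\<pi> i)"
  shows "\<exists>f\<in>vectors (direct_sum_rep I \<pi>). \<forall>g.
     ip (direct_sum_rep I \<pi>) (act (direct_sum_rep I \<pi>) g f) f = ip (\<pi> i) (act (\<pi> i) g \<nu>) \<nu>"
proof (intro bexI allI)
  define f where "f = (\<lambda>j\<in>I. if j = i then \<nu> else (\<lambda>_. 0))"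
  have zero: "(\<lambda>_. 0) \<in> vectors (\<pi> j)" "ip (\<pi> j) \<xi> (\<lambda>_. 0) = 0" for j \<xi>
    by (simp_all add: \<pi>_def permutation_rep_def ell2_def ell2_ip_def)
  have "(\<lambda>j. Re (ip (\<pi> j) (f j) (f j))) summable_on I"
    by (rule finite_nonzero_values_imp_summable_on, rule finite_subset[of _ "{i}"])
       (auto simp: f_def zero)
  then show "f \<in> vectors (direct_sum_rep I \<pi>)"
    using \<nu> by (auto simp: direct_sum_rep_def f_def zero)
  fix g
  have "ip (direct_sum_rep I \<pi>) (act (direct_sum_rep I \<pi>) g f) f
      = (\<Sum>\<^sub>\<infinity>j\<in>I. ip (\<pi> j) (act (\<pi> j) g (f j)) (f j))"
    by (auto simp: direct_sum_rep_def intro: infsum_cong)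
  also have "\<dots> = (\<Sum>\<^sub>\<infinity>j\<in>{i}. ip (\<pi> j) (act (\<pi> j) g (f j)) (f j))"
    using i by (intro infsum_cong_neutral) (auto simp: f_def zero)
  finally show "ip (direct_sum_rep I \<pi>) (act (direct_sum_rep I \<pi>) g f) f
      = ip (\<pi> i) (act (\<pi> i) g \<nu>) \<nu>"
    using i by (simp add: f_def)
qed

text \<open>The set to be moved consists of the nontrivial quotients of elements of \<open>E\<close>.  It is fixed
  before the summand is chosen, so the choice of \<open>i\<close> is free to depend on \<open>K\<close>.\<close>

lemma (in group) regular_weakly_contained_direct_sum:
  fixes X :: "'i \<Rightarrow> 'x set" and \<alpha> :: "'i \<Rightarrow> 'a \<Rightarrow> 'x \<Rightarrow> 'x"
  assumes actions: "\<And>i. i \<in> I \<Longrightarrow> set_action G (X i) (\<alpha> i)"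
    and moved: "\<And>K. \<lbrakk>finite K; K \<subseteq> carrier G - {\<one>}\<rbrakk>
                  \<Longrightarrow> \<exists>i\<in>I. \<exists>x\<in>X i. \<forall>g\<in>K. \<alpha> i g x \<noteq> x"
  shows "weakly_contained G (regular_rep G)
           (direct_sum_rep I (\<lambda>i. permutation_rep G (X i) (\<alpha> i)))"
proof (rule weakly_contained_regularI)
  fix F K and \<xi> :: "'a \<Rightarrow> complex"
  assume F: "finite F" "F \<subseteq> carrier G" and \<xi>: "\<And>h. h \<notin> F \<Longrightarrow> \<xi> h = 0"
    and K: "finite K" "K \<subseteq> carrier G"
  define E where "E = F \<union> (\<lambda>(g, h). inv g \<otimes> h) ` (K \<times> F)"
  have E: "finite E" "E \<subseteq> carrier G" using F K by (auto simp: E_def)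
  let ?D = "(\<lambda>(h, k). inv h \<otimes> k) ` (E \<times> E) - {\<one>}"
  have "finite ?D" "?D \<subseteq> carrier G - {\<one>}" using E by auto
  from moved[OF this] obtain i x where ix: "i \<in> I" "x \<in> X i" "\<And>g. g \<in> ?D \<Longrightarrow> \<alpha> i g x \<noteq> x"
    by blast
  interpret set_action G "X i" "\<alpha> i" by (rule actions) (rule ix)
  have "inj_on (\<lambda>h. \<alpha> i h x) E" by (rule inj_on_orbit_map[OF E(2) ix(2,3)])
  from finite_support_coeff_transfer[where \<xi> = \<xi>, OF F \<xi> K(2) ix(2) E_def this]
  obtain \<nu> where \<nu>: "\<nu> \<in> vectors (permutation_rep G (X i) (\<alpha> i))"
    "\<And>g. g \<in> K \<Longrightarrow> ip (permutation_rep G (X i) (\<alpha> i))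
        (act (permutation_rep G (X i) (\<alpha> i)) g \<nu>) \<nu>
      = (\<Sum>\<^sub>\<infinity>h\<in>carrier G. \<xi> (inv g \<otimes> h) * cnj (\<xi> h))" by blast
  show "\<exists>f\<in>vectors (direct_sum_rep I (\<lambda>i. permutation_rep G (X i) (\<alpha> i))). \<forall>g\<in>K.
      ip (direct_sum_rep I (\<lambda>i. permutation_rep G (X i) (\<alpha> i)))
        (act (direct_sum_rep I (\<lambda>i. permutation_rep G (X i) (\<alpha> i))) g f) f
      = (\<Sum>\<^sub>\<infinity>h\<in>carrier G. \<xi> (inv g \<otimes> h) * cnj (\<xi> h))"
    (is "\<exists>f\<in>vectors ?R. _")
  proof -
    obtain f where "f \<in> vectors ?R"
      "\<And>g. ip ?R (act ?R g f) f =
         ip (permutation_rep G (X i) (\<alpha> i)) (act (permutation_rep G (X i) (\<alpha> i)) g \<nu>) \<nu>"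
      using direct_sum_component_coeff[of i I \<nu> G X \<alpha>, OF ix(1) \<nu>(1)] by blast
    then show ?thesis using \<nu>(2) by (intro bexI[of _ f] ballI) simp_all
  qed
qed

lemma (in set_action) regular_weakly_contained:
  assumes moved: "\<And>K. \<lbrakk>finite K; K \<subseteq> carrier G - {\<one>}\<rbrakk> \<Longrightarrow> \<exists>x\<in>X. \<forall>g\<in>K. \<alpha> g x \<noteq> x"
  shows "weakly_contained G (regular_rep G) (permutation_rep G X \<alpha>)"
proof (rule weakly_contained_regularI)
  fix F K and \<xi> :: "'g \<Rightarrow> complex"
  assume F: "finite F" "F \<subseteq> carrier G" and \<xi>: "\<And>h. h \<notin> F \<Longrightarrow> \<xi> h = 0"
    and K: "finite K" "K \<subseteq> carrier G"
  define E where "E = F \<union> (\<lambda>(g, h). inv g \<otimes> h) ` (K \<times> F)"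
  have E: "finite E" "E \<subseteq> carrier G" using F K by (auto simp: E_def)
  let ?D = "(\<lambda>(h, k). inv h \<otimes> k) ` (E \<times> E) - {\<one>}"
  have "finite ?D" "?D \<subseteq> carrier G - {\<one>}" using E by auto
  from moved[OF this] obtain x where x: "x \<in> X" "\<And>g. g \<in> ?D \<Longrightarrow> \<alpha> g x \<noteq> x"
    by blast
  from finite_support_coeff_transfer[where \<xi> = \<xi>, OF F \<xi> K(2) x(1) E_def inj_on_orbit_map[OF E(2) x]]
  show "\<exists>\<nu>\<in>vectors (permutation_rep G X \<alpha>). \<forall>g\<in>K.
      ip (permutation_rep G X \<alpha>) (act (permutation_rep G X \<alpha>) g \<nu>) \<nu> =
      (\<Sum>\<^sub>\<infinity>h\<in>carrier G. \<xi> (inv g \<otimes> h) * cnj (\<xi> h))" .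
qed

lemma (in set_action) tuple_action:
  "set_action G {xs. set xs \<subseteq> X \<and> length xs = n} (\<lambda>g. map (\<alpha> g))"
  by unfold_locales (auto simp: act_closed act_mult act_one subset_iff intro!: map_idI)

section \<open>Uniqueness of geodesics in a tree\<close>

context tree
begin

text \<open>Two walks with common ends that meet only at equal times bound a cycle: cutting at their
  meeting points reduces to the case where they meet only at the ends, and then walking along \<open>p\<close>
  and back along \<open>q\<close> visits no vertex twice.  Walks with at most one edge are determined by their
  ends and bound no cycle.\<close>

lemma no_parallel_walks:
  assumes "successively adj p" "successively adj q" "set p \<subseteq> V" "set q \<subseteq> V"
    "distinct p" "distinct q" "length p = length q" "p \<noteq> []" "hd p = hd q" "last p = last q"
    and cross: "\<And>a b. \<lbrakk>a < length p; b < length q; p ! a = q ! b\<rbrakk> \<Longrightarrow> a = b"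
  shows "p = q"
  using assms
proof (induction "length p" arbitrary: p q rule: less_induct)
  case less
  note sp = less.prems(1) and sq = less.prems(2) and Vp = less.prems(3) and Vq = less.prems(4)
    and dp = less.prems(5) and dq = less.prems(6) and len = less.prems(7) and ne = less.prems(8)
    and hd = less.prems(9) and last = less.prems(10) and cross = less.prems(11)
  have qne: "q \<noteq> []" using len ne by auto
  have ends: "p ! 0 = q ! 0" "p ! (length p - 1) = q ! (length p - 1)"
    using ne qne hd last len by (simp_all add: hd_conv_nth last_conv_nth)
  show ?case
  proof (cases "\<exists>a. 0 < a \<and> a < length p - 1 \<and> p ! a = q ! a")
    case True
    then obtain a where a: "0 < a" "a < length p - 1" "p ! a = q ! a" by blast
    have split: "successively adj (take n r) \<and> successively adj (drop n r)"
      if "successively adj r" for n and r :: "'v list"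
      using that by (metis append_take_drop_id successively_append_iff)
    have "take (Suc a) p = take (Suc a) q"
    proof (rule less.hyps)
      show "last (take (Suc a) p) = last (take (Suc a) q)"
        using a len by (simp add: take_Suc_conv_app_nth)
      fix i j assume "i < length (take (Suc a) p)" "j < length (take (Suc a) q)"
        "take (Suc a) p ! i = take (Suc a) q ! j"
      then show "i = j" using cross[of i j] by simp
    qed (use a len ne sp sq dp dq hd Vp Vq in \<open>auto simp: split dest: in_set_takeD\<close>)
    moreover have "drop a p = drop a q"
    proof (rule less.hyps)
      show "hd (drop a p) = hd (drop a q)"
        using a len by (simp add: hd_drop_conv_nth)
      fix i j assume "i < length (drop a p)" "j < length (drop a q)"
        "drop a p ! i = drop a q ! j"
      then show "i = j" using cross[of "a + i" "a + j"] by simp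
    qed (use a len ne sp sq dp dq last Vp Vq in \<open>auto simp: split dest: in_set_dropD\<close>)
    moreover have "drop (Suc a) r = tl (drop a r)" for r :: "'v list"
      by (simp add: drop_Suc tl_drop)
    ultimately show ?thesis by (metis append_take_drop_id)
  next
    case False
    show ?thesis
    proof (cases "length p \<le> 2")
      case True
      show ?thesis
      proof (rule nth_equalityI[OF len])
        fix i assume "i < length p"
        then have "i = 0 \<or> i = length p - 1" using True by auto
        then show "p ! i = q ! i" using ends by auto
      qed
    next
      case large: False
      \<comment> \<open>The interior of \<open>q\<close>, which is nonempty and avoids \<open>p\<close>.\<close>
      define r where "r = tl (butlast q)"
      have r_nth: "r ! j = q ! Suc j" if "j < length r" for j
        using that by (simp add: r_def nth_tl nth_butlast)
      have r_len: "length r = length q - 2" by (simp add: r_def)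
      have q_eq: "q = q ! 0 # r @ [last q]"
      proof (rule nth_equalityI)
        show "length q = length (q ! 0 # r @ [last q])" using r_len large len by simp
        fix i assume "i < length q"
        then show "q ! i = (q ! 0 # r @ [last q]) ! i"
          using r_nth r_len large len qne
          by (auto simp: nth_Cons nth_append last_conv_nth split: nat.split
                   intro!: arg_cong[where f = "(!) q"])
      qed
      have rne: "r \<noteq> []" using r_len large len by auto
      have "distinct r" "successively adj r" "adj (q ! 0) (hd r)" "adj (last r) (last q)" "set r \<subseteq> V"
        using dq sq Vq rne
        by (subst (asm) (1 2 3) q_eq, auto simp: successively_Cons successively_append_iff)+
      have disj: "set p \<inter> set r = {}"
      proof (rule ccontr)
        assume "set p \<inter> set r \<noteq> {}"
        then obtain i j where ij: "i < length p" "j < length r" "p ! i = r ! j"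
          by (auto simp: set_eq_iff in_set_conv_nth)
        then have "i = Suc j" using r_nth r_len cross[of i "Suc j"] by simp
        then have "0 < i" "i < length p - 1" "p ! i = q ! i"
          using ij r_nth[of j] r_len len by simp_all
        then show False using False by blast
      qed
      have "graph_cycle V adj (p @ rev r)"
        unfolding graph_cycle_def
      proof (intro conjI)
        show "3 \<le> length (p @ rev r)" using large by simp
        show "distinct (p @ rev r)" using dp \<open>distinct r\<close> disj by auto
        show "set (p @ rev r) \<subseteq> V" using Vp \<open>set r \<subseteq> V\<close> by auto
        have "successively adj (rev r)"
          using \<open>successively adj r\<close> by (auto simp: adj_sym elim: successively_mono)
        then show "successively adj (p @ rev r)"
          using sp \<open>adj (last r) (last q)\<close> last rne
          by (auto simp: successively_append_iff hd_rev adj_sym)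
        have "last (p @ rev r) = hd r" using rne by (simp add: last_rev)
        moreover have "hd (p @ rev r) = q ! 0" using ne hd hd_conv_nth[OF qne] by simp
        ultimately show "adj (last (p @ rev r)) (hd (p @ rev r))"
          using adj_sym[OF \<open>adj (q ! 0) (hd r)\<close>] by simp
      qed
      then show ?thesis using tree_acyclic by blast
    qed
  qed
qed

lemma geodesic_le_walk:
  assumes "geodesic V adj x y p" "walk V adj x y w"
  shows "length p \<le> length w"
proof -
  have "\<exists>p. walk V adj x y p \<and> length p = Suc (length w - 1)"
    using assms(2) by (auto simp: walk_def intro!: exI[of _ w])
  then have "graph_dist V adj x y \<le> length w - 1" unfolding graph_dist_def by (rule Least_le)
  moreover have "length w > 0" using assms(2) by (simp add: walk_def)
  ultimately show ?thesis using assms(1) unfolding geodesic_def by linarith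
qed

text \<open>Otherwise \<open>p\<close> would reach the common vertex earlier than \<open>q\<close>, and following \<open>p\<close> up to it and
  \<open>q\<close> from there on would give a shorter walk than a geodesic.\<close>

lemma geodesics_cross_at_same_time:
  assumes p: "geodesic V adj x y p" and q: "geodesic V adj x y q"
    and ab: "a < length p" "b < length q" "p ! a = q ! b"
  shows "b \<le> a"
proof -
  have wp: "walk V adj x y p" and wq: "walk V adj x y q"
    and len: "length p = length q" using p q by (auto simp: geodesic_def)
  let ?w = "take (Suc a) p @ drop (Suc b) q"
  have "walk V adj x y ?w"
    unfolding walk_def
  proof (intro conjI)
    show "?w \<noteq> []" "hd ?w = x" using wp ab by (auto simp: walk_def)
    show "set ?w \<subseteq> V" using wp wq by (auto simp: walk_def dest: in_set_takeD in_set_dropD)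
    have lt: "last (take (Suc a) p) = q ! b" using ab by (simp add: take_Suc_conv_app_nth)
    show "last ?w = y"
    proof (cases "Suc b < length q")
      case True
      then show ?thesis using wq by (simp add: walk_def)
    next
      case False
      then have "b = length q - 1" using ab by simp
      then show ?thesis using False lt wq by (auto simp: walk_def last_conv_nth)
    qed
    have "successively adj (take (Suc a) p)" 
      using wp by (metis walk_def append_take_drop_id successively_append_iff)
    moreover have "successively adj (drop b q)"
      using wq by (metis walk_def append_take_drop_id successively_append_iff)
    moreover have "drop b q = q ! b # drop (Suc b) q" using ab by (simp add: Cons_nth_drop_Suc)
    ultimately show "successively adj ?w"
      using lt by (auto simp: successively_append_iff successively_Cons)
  qed
  from geodesic_le_walk[OF p this] show ?thesis using ab len by auto
qed

lemma geodesic_unique: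
  assumes p: "geodesic V adj x y p" and q: "geodesic V adj x y q"
  shows "p = q"
proof (rule no_parallel_walks)
  show "distinct p" "distinct q"
    using geodesics_cross_at_same_time[OF p p] geodesics_cross_at_same_time[OF q q]
    by (metis distinct_conv_nth antisym)+
  show "a = b" if "a < length p" "b < length q" "p ! a = q ! b" for a b
    using geodesics_cross_at_same_time[OF p q that] 
      geodesics_cross_at_same_time[OF q p that(2,1) that(3)[symmetric]] by simp
qed (use p q in \<open>auto simp: geodesic_def walk_def\<close>)

end

section \<open>Vertices moved by finitely many group elements\<close>

context rooted_tree_action
begin

lemma vertex_set_action: "set_action G V \<phi>"
proof -
  interpret group G using group_hom group_hom.axioms(1) by blast
  show ?thesis
  proof
    show "\<phi> \<one> x = x" if "x \<in> V" for x using that by (metis id_eq_one restrict_apply')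
  qed (auto simp: element_image[OF _ _ refl] composition_rule)
qed

text \<open>The image under \<open>g\<close> of the geodesic from the root to \<open>w\<close> is again a geodesic from the root to
  \<open>w\<close>, hence the same list of vertices.\<close>

lemma fixes_ancestors:
  assumes g: "g \<in> carrier G" and w: "w \<in> subtree V adj rt v" and gw: "\<phi> g w = w"
  shows "\<phi> g v = v"
proof -
  obtain p where p: "geodesic V adj rt w p" "v \<in> set p" using w by (auto simp: subtree_def)
  then have pw: "p \<noteq> []" "hd p = rt" "last p = w" "set p \<subseteq> V" "successively adj p"
    by (auto simp: geodesic_def walk_def)
  have "successively adj (map (\<phi> g) p)"
    unfolding successively_map
    by (rule successively_mono[OF pw(5)]) (use pw(4) g in \<open>simp add: adj_preserved subset_iff\<close>)
  then have "geodesic V adj rt w (map (\<phi> g) p)"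
    using p pw g gw by (auto simp: geodesic_def walk_def hd_map last_map root_fixed element_image[OF _ _ refl])
  with p(1) have "map (\<phi> g) p = p" by (rule geodesic_unique[symmetric])
  then have "map (\<phi> g) p = map id p" by simp
  then show ?thesis using p(2) unfolding map_eq_conv by simp
qed

text \<open>Descending the tree: if \<open>v\<close> is moved by all elements so far and \<open>g\<close> is the next one, some
  descendant \<open>w\<close> of \<open>v\<close> is moved by \<open>g\<close>, and \<open>w\<close> is still moved by the earlier elements, because
  an element fixing \<open>w\<close> fixes its ancestor \<open>v\<close>.  The descent starts at the root.\<close>

lemma ex_vertex_moved_by_all:
  assumes "finite K" and "K \<subseteq> carrier G"
    and "\<And>v. v \<in> V \<Longrightarrow> K \<inter> pointwise_stabilizer G \<phi> (subtree V adj rt v) = {}"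
  shows "\<exists>v\<in>V. \<forall>g\<in>K. \<phi> g v \<noteq> v"
  using assms
proof (induction K)
  case empty
  then show ?case using root_in by blast
next
  case (insert g K)
  then obtain v where v: "v \<in> V" "\<forall>h\<in>K. \<phi> h v \<noteq> v" by blast
  have "g \<notin> pointwise_stabilizer G \<phi> (subtree V adj rt v)" using insert.prems v by blast
  then obtain w where w: "w \<in> subtree V adj rt v" "\<phi> g w \<noteq> w"
    using insert.prems by (auto simp: pointwise_stabilizer_def)
  have "w \<in> V" using w by (simp add: subtree_def)
  moreover have "\<phi> h w \<noteq> w" if "h \<in> K" for h
    using fixes_ancestors[of h w v] w v that insert.prems by auto
  ultimately show ?case using w by blast
qed

lemma ex_moved_vertex:
  assumes "faithful_action G V \<phi>" and g: "g \<in> carrier G - {\<one>}"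
  shows "\<exists>v\<in>V. \<phi> g v \<noteq> v"
proof (rule ccontr)
  assume "\<not> ?thesis"
  then have fix_all: "\<phi> g v = v" if "v \<in> V" for v using that by blast
  interpret group G using group_hom group_hom.axioms(1) by blast
  have "\<phi> g = \<phi> \<one>"
  proof (rule extensionalityI[of _ V])
    show "\<phi> g \<in> extensional V" "\<phi> \<one> \<in> extensional V"
      using bij_prop0[of g] bij_prop0[of \<one>] g by (simp_all add: Bij_def)
    show "\<phi> g v = \<phi> \<one> v" if "v \<in> V" for v
      using that fix_all by (simp flip: id_eq_one)
  qed
  then have "g = \<one>"
    using faithful_action.faithful[OF assms(1)] g by (auto dest: inj_onD)
  with g show False by blast
qed

end

theorem theorem4p1:
  fixes G :: "('g, 'm) monoid_scheme"
    and V :: "'v set" and adj :: "'v \<Rightarrow> 'v \<Rightarrow> bool" and rt :: 'v and d :: "nat \<Rightarrow> nat"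
    and \<phi> :: "'g \<Rightarrow> 'v \<Rightarrow> 'v"
  assumes "rooted_tree_action V adj rt d G \<phi>"
    and "faithful_action G V \<phi>"
    and "countable (carrier G)"
  shows
    "((\<forall>v\<in>V. pointwise_stabilizer G \<phi> (subtree V adj rt v) = {\<one>\<^bsub>G\<^esub>}) \<longrightarrow>
        weakly_contained G (regular_rep G) (permutation_rep G V \<phi>))
     \<and> (\<forall>n. finite (\<Union>v\<in>V. pointwise_stabilizer G \<phi> (subtree V adj rt v)) \<and>
            card (\<Union>v\<in>V. pointwise_stabilizer G \<phi> (subtree V adj rt v)) = n \<longrightarrow>
        weakly_contained G (regular_rep G) (permutation_rep_power G V \<phi> n))
     \<and> weakly_contained G (regular_rep G)
          (direct_sum_rep {1..} (permutation_rep_power G V \<phi>))"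
proof -
  interpret rooted_tree_action V adj rt d G \<phi> by fact
  interpret set_action G V \<phi> by (rule vertex_set_action)
  let ?S = "\<Union>v\<in>V. pointwise_stabilizer G \<phi> (subtree V adj rt v)"
  have "\<forall>g\<in>carrier G - {\<one>\<^bsub>G\<^esub>}. \<exists>v. v \<in> V \<and> \<phi> g v \<noteq> v"
    using ex_moved_vertex[OF assms(2)] by blast
  from bchoice[OF this] obtain m
    where m: "\<And>g. g \<in> carrier G - {\<one>\<^bsub>G\<^esub>} \<Longrightarrow> m g \<in> V \<and> \<phi> g (m g) \<noteq> m g" by blast
  \<comment> \<open>A tuple is moved as soon as one entry is.  The first entry \<open>v\<close> takes care of \<open>K\<close> at once,
    each further entry of a single element of \<open>T\<close>.\<close>
  have tuple: "\<exists>xs. set xs \<subseteq> V \<and> length xs = Suc (card T) \<and> (\<forall>g\<in>T \<union> K. map (\<phi> g) xs \<noteq> xs)"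
    if T: "finite T" "T \<subseteq> carrier G - {\<one>\<^bsub>G\<^esub>}" and v: "v \<in> V" "\<forall>g\<in>K. \<phi> g v \<noteq> v" for T K v
  proof -
    obtain ts where ts: "set ts = T" "distinct ts" using finite_distinct_list[OF T(1)] by blast
    show ?thesis
    proof (intro exI[of _ "v # map m ts"] conjI ballI)
      show "set (v # map m ts) \<subseteq> V" using v m T ts by auto
      show "length (v # map m ts) = Suc (card T)" using ts by (simp flip: distinct_card)
      fix g assume g: "g \<in> T \<union> K"
      show "map (\<phi> g) (v # map m ts) \<noteq> v # map m ts"
      proof (cases "g \<in> K")
        case False
        then have "g \<in> set ts" "\<phi> g (m g) \<noteq> m g" using g ts T m by auto
        then show ?thesis by (auto simp: map_eq_conv)
      qed (use v in simp)
    qed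
  qed
  have "weakly_contained G (regular_rep G) (permutation_rep G V \<phi>)"
    if triv: "\<forall>v\<in>V. pointwise_stabilizer G \<phi> (subtree V adj rt v) = {\<one>\<^bsub>G\<^esub>}"
  proof (rule regular_weakly_contained)
    fix K assume "finite K" "K \<subseteq> carrier G - {\<one>\<^bsub>G\<^esub>}"
    with triv show "\<exists>v\<in>V. \<forall>g\<in>K. \<phi> g v \<noteq> v" by (intro ex_vertex_moved_by_all) auto
  qed
  moreover have "weakly_contained G (regular_rep G) (permutation_rep_power G V \<phi> (card ?S))"
    if fin: "finite ?S"
    unfolding permutation_rep_power_def
  proof (rule set_action.regular_weakly_contained[OF tuple_action])
    fix K assume K: "finite K" "K \<subseteq> carrier G - {\<one>\<^bsub>G\<^esub>}"
    \<comment> \<open>The identity needs no entry of its own, which leaves room for the vertex moving \<open>K - ?S\<close>.\<close>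
    have "\<one>\<^bsub>G\<^esub> \<in> ?S" using root_in by (auto simp: pointwise_stabilizer_def subtree_def act_one)
    then have card: "Suc (card (?S - {\<one>\<^bsub>G\<^esub>})) = card ?S" using fin by (simp only: card_Suc_Diff1)
    have "\<exists>v\<in>V. \<forall>g\<in>K - ?S. \<phi> g v \<noteq> v" using K by (intro ex_vertex_moved_by_all) auto
    then obtain v where v: "v \<in> V" "\<forall>g\<in>K - ?S. \<phi> g v \<noteq> v" by blast
    have "?S - {\<one>\<^bsub>G\<^esub>} \<subseteq> carrier G - {\<one>\<^bsub>G\<^esub>}" by (auto simp: pointwise_stabilizer_def)
    from tuple[OF _ this v] fin card
    obtain xs where "set xs \<subseteq> V" "length xs = card ?S" 
      "\<forall>g\<in>(?S - {\<one>\<^bsub>G\<^esub>}) \<union> (K - ?S). map (\<phi> g) xs \<noteq> xs" by auto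
    with K show "\<exists>xs\<in>{xs. set xs \<subseteq> V \<and> length xs = card ?S}. \<forall>g\<in>K. map (\<phi> g) xs \<noteq> xs" 
      by (intro bexI[of _ xs]) blast+
  qed
  moreover have "weakly_contained G (regular_rep G)
      (direct_sum_rep {1..} (permutation_rep_power G V \<phi>))"
    unfolding permutation_rep_power_def
  proof (rule regular_weakly_contained_direct_sum[OF tuple_action])
    fix K assume K: "finite K" "K \<subseteq> carrier G - {\<one>\<^bsub>G\<^esub>}"
    \<comment> \<open>The root as an additional entry makes the length positive even when \<open>K\<close> is empty.\<close>
    from tuple[OF K root_in, of "{}"] obtain xs
      where xs: "set xs \<subseteq> V" "length xs = Suc (card K)" "\<forall>g\<in>K. map (\<phi> g) xs \<noteq> xs" by auto
    then show "\<exists>n\<in>{1..}. \<exists>xs\<in>{xs. set xs \<subseteq> V \<and> length xs = n}. \<forall>g\<in>K. map (\<phi> g) xs \<noteq> xs"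
      by (intro bexI[of _ "Suc (card K)"] bexI[of _ xs]) auto
  qed
  ultimately show ?thesis by blast
qed

end
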